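(* Let $G=(V,E)$ be a unimodular transitive graph, let $d$ be the degree of $G$, and let the agents' initial opinions $\{X_0(i)\}_{i\in V}$ be chosen from a distribution on $\{-1,+1\}^V$ that is $\mathrm{Aut}(G)$-invariant. Let $X_t(i)$, $t\ge 0$, be the opinions obtained from these initial opinions by majority dynamics. Then for every $i\in V$, $$\mathbb{P}\left[\lim_{t\to\infty}\big(X_{t+2}(i)-X_t(i)\big)=0\right]=1,$$ and furthermore $$\mathbb{E}\left[\#\{t\ge 0 : X_{t+2}(i)\neq X_t(i)\}\right]\le 2d.$$
   Context: Graphs $G=(V,E)$ are finite or countably infinite, locally finite, undirected and simple. Majority dynamics: for times $t\in\{0,1,2,\dots\}$ and $i\in V$, $X_t(i)\in\{-1,+1\}$ is the opinion of vertex $i$ at time $t$, and $$X_{t+1}(i)=\mathrm{sgn}\sum_{j\in\partial(i)}X_t(j),$$ where $\partial(i)$ is the set of neighbors of $i$ in $G$, with $i$ itself added to $\partial(i)$ when the number of neighbors of $i$ is even, so that $|\partial(i)|$ is odd and the sum is never zero (equivalently, ties are broken by keeping the vertex's existing opinion). All vertices update synchronously. $\mathrm{Aut}(G)$ is the group of graph automorphisms of $G$. $G$ is transitive if for all $i,j\in V$ there is $h\in\mathrm{Aut}(G)$ with $h(i)=j$. $G$ is unimodular if $\mathrm{Aut}(G)$ is a unimodular group; equivalently, if the mass transport principle holds: for every $f:V\times V\to\mathbb{R}^+$ that is invariant under the diagonal action of $\mathrm{Aut}(G)$, $\sum_{j\in\partial(i)}f(i,j)=\sum_{j\in\partial(i)}f(j,i)$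 for any $i\in V$. A distribution on $\{-1,+1\}^V$ is $\mathrm{Aut}(G)$-invariant if it is preserved by the natural action of $\mathrm{Aut}(G)$ on labelings of $V$. *)

theory Defs
  imports "HOL-Probability.Probability" "HOL-Algebra.Coset"
begin

section \<open>Unimodular topological groups\<close>

definition topological_group :: "('g, 'm) monoid_scheme \<Rightarrow> 'g topology \<Rightarrow> bool" where
  "topological_group G T \<longleftrightarrow>
     group G \<and> topspace T = carrier G \<and>
     continuous_map (prod_topology T T) T (\<lambda>(x, y). x \<otimes>\<^bsub>G\<^esub> y) \<and>
     continuous_map T T (\<lambda>x. inv\<^bsub>G\<^esub> x)"

text \<open>Nonzero Radon measures on the Borel sets of a Hausdorff space.\<close>

definition nonzero_Radon_measure :: "'g topology \<Rightarrow> 'g measure \<Rightarrow> bool" where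
  "nonzero_Radon_measure T M \<longleftrightarrow>
     space M = topspace T \<and>
     sets M = sigma_sets (topspace T) {U. openin T U} \<and>
     emeasure M (space M) \<noteq> 0 \<and>
     (\<forall>K. compactin T K \<longrightarrow> emeasure M K < \<infinity>) \<and>
     (\<forall>A\<in>sets M. emeasure M A = (INF U\<in>{U. openin T U \<and> A \<subseteq> U}. emeasure M U)) \<and>
     (\<forall>U. openin T U \<longrightarrow> emeasure M U = (SUP K\<in>{K. compactin T K \<and> K \<subseteq> U}. emeasure M K))"

definition left_Haar_measure ::
    "('g, 'm) monoid_scheme \<Rightarrow> 'g topology \<Rightarrow> 'g measure \<Rightarrow> bool" where
  "left_Haar_measure G T M \<longleftrightarrow>
     nonzero_Radon_measure T M \<and>
     (\<forall>g\<in>carrier G. \<forall>A\<in>sets M. emeasure M (g <#\<^bsub>G\<^esub> A) = emeasure M A)"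

definition right_Haar_measure ::
    "('g, 'm) monoid_scheme \<Rightarrow> 'g topology \<Rightarrow> 'g measure \<Rightarrow> bool" where
  "right_Haar_measure G T M \<longleftrightarrow>
     nonzero_Radon_measure T M \<and>
     (\<forall>g\<in>carrier G. \<forall>A\<in>sets M. emeasure M (A #>\<^bsub>G\<^esub> g) = emeasure M A)"

text \<open>A left Haar measure on a locally compact group exists and is unique up to a positive
  factor, so it does not matter whether one or every left Haar measure is required to be
  right invariant.\<close>

definition unimodular_group :: "('g, 'm) monoid_scheme \<Rightarrow> 'g topology \<Rightarrow> bool" where
  "unimodular_group G T \<longleftrightarrow>
     topological_group G T \<and> Hausdorff_space T \<and> locally_compact_space T \<and>
     (\<exists>M. left_Haar_measure G T M \<and> right_Haar_measure G T M)"


section \<open>Graphs and their automorphisms\<close>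

text \<open>A graph is an adjacency relation on a countable (finite or infinite) vertex type.\<close>

definition neighbors :: "('v \<Rightarrow> 'v \<Rightarrow> bool) \<Rightarrow> 'v \<Rightarrow> 'v set" where
  "neighbors E i = {j. E i j}"

definition vertex_degree :: "('v \<Rightarrow> 'v \<Rightarrow> bool) \<Rightarrow> 'v \<Rightarrow> nat" where
  "vertex_degree E i = card (neighbors E i)"

definition locally_finite_simple_graph :: "('v::countable \<Rightarrow> 'v \<Rightarrow> bool) \<Rightarrow> bool" where
  "locally_finite_simple_graph E \<longleftrightarrow> symp E \<and> irreflp E \<and> (\<forall>i. finite (neighbors E i))"

definition automorphisms :: "('v \<Rightarrow> 'v \<Rightarrow> bool) \<Rightarrow> ('v \<Rightarrow> 'v) set" where
  "automorphisms E = {h. bij h \<and> (\<forall>i j. E (h i) (h j) \<longleftrightarrow> E i j)}"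

definition Aut_group :: "('v \<Rightarrow> 'v \<Rightarrow> bool) \<Rightarrow> ('v \<Rightarrow> 'v) monoid" where
  "Aut_group E = \<lparr>carrier = automorphisms E, mult = (\<circ>), one = id\<rparr>"

text \<open>The topology of pointwise convergence, with the vertices discrete.\<close>

definition Aut_topology :: "('v \<Rightarrow> 'v \<Rightarrow> bool) \<Rightarrow> ('v \<Rightarrow> 'v) topology" where
  "Aut_topology E =
     subtopology (product_topology (\<lambda>_. discrete_topology UNIV) UNIV) (automorphisms E)"

definition unimodular_graph :: "('v \<Rightarrow> 'v \<Rightarrow> bool) \<Rightarrow> bool" where
  "unimodular_graph E \<longleftrightarrow> unimodular_group (Aut_group E) (Aut_topology E)"

definition transitive_graph :: "('v \<Rightarrow> 'v \<Rightarrow> bool) \<Rightarrow> bool" where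
  "transitive_graph E \<longleftrightarrow> (\<forall>i j. \<exists>h\<in>automorphisms E. h i = j)"


section \<open>Majority dynamics\<close>

definition opinion_space :: "('v \<Rightarrow> int) measure" where
  "opinion_space = PiM UNIV (\<lambda>_. count_space {-1, 1})"

definition Aut_invariant :: "('v \<Rightarrow> 'v \<Rightarrow> bool) \<Rightarrow> ('v \<Rightarrow> int) measure \<Rightarrow> bool" where
  "Aut_invariant E D \<longleftrightarrow> (\<forall>h\<in>automorphisms E. distr D opinion_space (\<lambda>x. x \<circ> inv_into UNIV h) = D)"

definition voters :: "('v \<Rightarrow> 'v \<Rightarrow> bool) \<Rightarrow> 'v \<Rightarrow> 'v set" where
  "voters E i = (if even (vertex_degree E i) then insert i (neighbors E i) else neighbors E i)"

definition majority_step :: "('v \<Rightarrow> 'v \<Rightarrow> bool) \<Rightarrow> ('v \<Rightarrow> int) \<Rightarrow> 'v \<Rightarrow> int" where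
  "majority_step E x i = sgn (\<Sum>j\<in>voters E i. x j)"

definition majority_dynamics :: "('v \<Rightarrow> 'v \<Rightarrow> bool) \<Rightarrow> ('v \<Rightarrow> int) \<Rightarrow> nat \<Rightarrow> 'v \<Rightarrow> int" where
  "majority_dynamics E x t = (majority_step E ^^ t) x"

end

theory Submission
  imports Defs
begin

text \<open>
  Let \<open>e(t)\<close> be the expected number of voters \<open>j\<close> of a fixed vertex \<open>i\<close> whose opinion at time
  \<open>t\<close> differs from the opinion of \<open>i\<close> at time \<open>t + 1\<close>. By mass transport, \<open>e(t)\<close> is also the
  expected number of voters \<open>j\<close> whose opinion at time \<open>t + 1\<close> differs from that of \<open>i\<close> at time
  \<open>t\<close>. Given the opinions at time \<open>t + 1\<close>, the opinion of \<open>i\<close> at time \<open>t + 2\<close> is the sign that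
  disagrees with the fewest voters, and the opposite sign disagrees with at least one more. Comparing
  the opinions of \<open>i\<close> at the times \<open>t\<close> and \<open>t + 2\<close> therefore shows that \<open>e(t) - e(t + 1)\<close> is at
  least the probability that they differ (\<open>energy_decrease\<close>). Telescoping, these probabilities
  sum to at most \<open>e(0) \<le> d\<close>. The sum is the expected number of changes between \<open>t\<close> and
  \<open>t + 2\<close>, so almost surely there are only finitely many of them.

  The mass transport identity along edges (\<open>mass_transport\<close>) comes from a bi-invariant Haar measure
  \<open>\<mu>\<close> on the automorphism group. For a connected graph let \<open>S(x, y)\<close> be the set of automorphisms
  that map \<open>x\<close> to \<open>y\<close>; by invariance and transitivity \<open>\<mu>(S(x, y))\<close> is a constant \<open>c\<close> with
  \<open>0 < c < \<infinity>\<close>. If \<open>h\<close> maps \<open>i\<close> to \<open>k\<close> and \<open>l\<close> to \<open>i\<close>, then \<open>f(i, k) = f(l, i)\<close>, so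
  splitting the sets \<open>S(i, k)\<close> according to the preimage \<open>l\<close> of \<open>i\<close> turns
  \<open>c \<Sum>\<^sub>k f(i, k)\<close> into \<open>c \<Sum>\<^sub>l f(l, i)\<close>.

  The graph need not be connected, and then vertex stabilizers may have infinite measure. Local
  compactness provides a finite set \<open>F\<close> whose pointwise stabilizer has finite measure. The argument
  is run in the subgroup fixing the part of \<open>F\<close> outside the component of \<open>i\<close>. This subgroup is still
  transitive on that component, since an automorphism preserving the component can be replaced by the
  identity elsewhere (\<open>glue_automorphism\<close>). In it the stabilizer of \<open>i\<close> has finite measure,
  since its orbits on the component are finite (\<open>emeasure_fixers_finite\<close>).
\<close>

section \<open>Automorphisms\<close>

lemma automorphism_bij: "h \<in> automorphisms E \<Longrightarrow> bij h"
  by (simp add: automorphisms_def)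

lemma automorphism_adj: "h \<in> automorphisms E \<Longrightarrow> E (h i) (h j) \<longleftrightarrow> E i j"
  by (simp add: automorphisms_def)

lemma automorphism_comp:
  assumes "g \<in> automorphisms E" "h \<in> automorphisms E"
  shows "g \<circ> h \<in> automorphisms E"
  using assms by (auto simp: automorphisms_def intro: bij_comp)

lemma automorphism_inv:
  assumes "h \<in> automorphisms E"
  shows "inv_into UNIV h \<in> automorphisms E"
proof -
  have b: "bij h" and e: "\<And>i j. E (h i) (h j) \<longleftrightarrow> E i j"
    using assms by (auto simp: automorphisms_def)
  have "E (inv_into UNIV h i) (inv_into UNIV h j) \<longleftrightarrow> E i j" for i j
    using e[of "inv_into UNIV h i" "inv_into UNIV h j"] b
    by (simp add: bij_is_surj surj_f_inv_f)
  then show ?thesis using b by (simp add: automorphisms_def bij_imp_bij_inv)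
qed

lemma automorphism_inv_simps:
  assumes "h \<in> automorphisms E"
  shows "inv_into UNIV h (h x) = x" "h (inv_into UNIV h x) = x"
  using automorphism_bij[OF assms] by (simp_all add: bij_is_surj surj_f_inv_f bij_is_inj)

lemma automorphism_path:
  assumes "h \<in> automorphisms E"
  shows "E\<^sup>*\<^sup>* (h i) (h j) \<longleftrightarrow> E\<^sup>*\<^sup>* i j"
proof -
  have fwd: "E\<^sup>*\<^sup>* (g i) (g j)" if "g \<in> automorphisms E" "E\<^sup>*\<^sup>* i j" for g i j
    using that(2)
  proof (induction rule: rtranclp_induct)
    case (step y z)
    then show ?case using automorphism_adj[OF that(1)] by (meson rtranclp.rtrancl_into_rtrancl)
  qed simp
  show ?thesis
    using fwd[OF assms, of i j] fwd[OF automorphism_inv[OF assms], of "h i" "h j"]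
    by (auto simp: automorphism_inv_simps[OF assms])
qed

lemma automorphism_neighbors:
  assumes "h \<in> automorphisms E"
  shows "neighbors E (h i) = h ` neighbors E i"
proof
  show "neighbors E (h i) \<subseteq> h ` neighbors E i"
  proof
    fix k assume "k \<in> neighbors E (h i)"
    then have "inv_into UNIV h k \<in> neighbors E i"
      using automorphism_adj[OF assms, of i "inv_into UNIV h k"]
      by (simp add: neighbors_def automorphism_inv_simps[OF assms])
    then show "k \<in> h ` neighbors E i"
      using automorphism_inv_simps(2)[OF assms, of k] by (metis imageI)
  qed
qed (auto simp: neighbors_def automorphism_adj[OF assms])

text \<open>An automorphism preserving the connected component of \<open>i\<close>, restricted to that component and
  extended by the identity, is again an automorphism.\<close>

lemma glue_automorphism:
  fixes E :: "'v \<Rightarrow> 'v \<Rightarrow> bool"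
  assumes sym: "symp E" and g: "g \<in> automorphisms E" and gi: "E\<^sup>*\<^sup>* i (g i)"
  shows "(\<lambda>x. if E\<^sup>*\<^sup>* i x then g x else x) \<in> automorphisms E"
proof -
  let ?h = "\<lambda>x. if E\<^sup>*\<^sup>* i x then g x else x"
  have symr: "E\<^sup>*\<^sup>* x y \<Longrightarrow> E\<^sup>*\<^sup>* y x" for x y
    using sym by (metis sympD symp_rtranclp)
  have in_iff: "E\<^sup>*\<^sup>* i (g x) \<longleftrightarrow> E\<^sup>*\<^sup>* i x" for x
    using automorphism_path[OF g, of i x] gi symr[OF gi] by (meson rtranclp_trans)
  have inj: "inj ?h"
  proof (rule injI)
    fix x y assume "?h x = ?h y"
    then show "x = y"
      using in_iff[of x] in_iff[of y] bij_is_inj[OF automorphism_bij[OF g]]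
      by (auto simp: inj_eq split: if_splits)
  qed
  have "\<exists>x. y = ?h x" for y
  proof (cases "E\<^sup>*\<^sup>* i y")
    case True
    then have "E\<^sup>*\<^sup>* i (inv_into UNIV g y)"
      using in_iff[of "inv_into UNIV g y"] by (simp add: automorphism_inv_simps[OF g])
    then show ?thesis
      by (intro exI[of _ "inv_into UNIV g y"]) (simp add: automorphism_inv_simps[OF g])
  next
    case False
    then show ?thesis by (intro exI[of _ y]) simp
  qed
  then have "surj ?h" unfolding surj_def by (rule allI)
  moreover have "E (?h x) (?h y) \<longleftrightarrow> E x y" for x y
  proof -
    have adj: "E\<^sup>*\<^sup>* i u \<longleftrightarrow> E\<^sup>*\<^sup>* i v" if "E u v" for u v
      using that sym by (meson rtranclp.rtrancl_into_rtrancl sympD)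
    show ?thesis
      using adj[of x y] adj[of "g x" y] adj[of x "g y"] in_iff[of x] in_iff[of y]
        automorphism_adj[OF g, of x y] by auto
  qed
  ultimately show ?thesis using inj by (simp add: automorphisms_def bij_def)
qed

section \<open>Pointwise stabilizers and Haar measure\<close>

text \<open>The pointwise stabilizer of the vertex set \<open>B\<close>.\<close>

definition fixers :: "('v \<Rightarrow> 'v \<Rightarrow> bool) \<Rightarrow> 'v set \<Rightarrow> ('v \<Rightarrow> 'v) set" where
  "fixers E B = {h \<in> automorphisms E. \<forall>x\<in>B. h x = x}"

text \<open>The automorphisms that fix \<open>B\<close> pointwise and map \<open>x\<close> to \<open>y\<close>. If nonempty, this is a left coset
  of the stabilizer of \<open>x\<close> in \<^term>\<open>fixers E B\<close> and a right coset of the stabilizer of \<open>y\<close>.\<close>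

definition transporters ::
    "('v \<Rightarrow> 'v \<Rightarrow> bool) \<Rightarrow> 'v set \<Rightarrow> 'v \<Rightarrow> 'v \<Rightarrow> ('v \<Rightarrow> 'v) set" where
  "transporters E B x y = {h \<in> fixers E B. h x = y}"

lemma fixers_comp: "g \<in> fixers E B \<Longrightarrow> h \<in> fixers E B \<Longrightarrow> g \<circ> h \<in> fixers E B"
  by (simp add: fixers_def automorphism_comp)

lemma fixers_inv:
  assumes "h \<in> fixers E B" shows "inv_into UNIV h \<in> fixers E B"
proof -
  have h: "h \<in> automorphisms E" "\<forall>x\<in>B. h x = x" using assms by (auto simp: fixers_def)
  have "inv_into UNIV h x = x" if "x \<in> B" for x
    using h(2) that automorphism_inv_simps(1)[OF h(1), of x] by simp
  then show ?thesis using automorphism_inv[OF h(1)] by (simp add: fixers_def)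
qed

lemma l_coset_transporters:
  assumes g: "g \<in> fixers E B"
  shows "g <#\<^bsub>Aut_group E\<^esub> transporters E B x y = transporters E B x (g y)"
proof
  have ga: "g \<in> automorphisms E" using g by (simp add: fixers_def)
  show "transporters E B x (g y) \<subseteq> g <#\<^bsub>Aut_group E\<^esub> transporters E B x y"
  proof
    fix h assume h: "h \<in> transporters E B x (g y)"
    have "inv_into UNIV g \<circ> h \<in> transporters E B x y"
      using h fixers_comp[OF fixers_inv[OF g], of h] automorphism_inv_simps(1)[OF ga]
      by (simp add: transporters_def)
    moreover have "h = g \<circ> (inv_into UNIV g \<circ> h)"
      by (rule ext) (simp add: automorphism_inv_simps[OF ga])
    ultimately show "h \<in> g <#\<^bsub>Aut_group E\<^esub> transporters E B x y"
      unfolding l_coset_def Aut_group_def by auto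
  qed
qed (auto simp: l_coset_def Aut_group_def transporters_def fixers_comp[OF g])

lemma r_coset_transporters:
  assumes g: "g \<in> fixers E B"
  shows "transporters E B (g x) y #>\<^bsub>Aut_group E\<^esub> g = transporters E B x y"
proof
  have ga: "g \<in> automorphisms E" using g by (simp add: fixers_def)
  show "transporters E B x y \<subseteq> transporters E B (g x) y #>\<^bsub>Aut_group E\<^esub> g"
  proof
    fix h assume h: "h \<in> transporters E B x y"
    have "h \<circ> inv_into UNIV g \<in> transporters E B (g x) y"
      using h fixers_comp[OF _ fixers_inv[OF g], of h] automorphism_inv_simps(1)[OF ga]
      by (simp add: transporters_def)
    moreover have "h = (h \<circ> inv_into UNIV g) \<circ> g"
      by (rule ext) (simp add: automorphism_inv_simps[OF ga])
    ultimately show "h \<in> transporters E B (g x) y #>\<^bsub>Aut_group E\<^esub> g"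
      unfolding r_coset_def Aut_group_def by auto
  qed
qed (auto simp: r_coset_def Aut_group_def transporters_def fixers_comp[OF _ g])

lemma topspace_Aut_topology: "topspace (Aut_topology E) = automorphisms E"
  by (simp add: Aut_topology_def)

lemma openin_Aut_value: "openin (Aut_topology E) {h \<in> automorphisms E. h x = y}"
proof -
  have "openin (product_topology (\<lambda>_. discrete_topology UNIV) UNIV) {h. h x = y}"
    using openin_continuous_map_preimage[OF continuous_map_product_projection[of x UNIV
      "\<lambda>_. discrete_topology UNIV"], of "{y}"] by simp
  then show ?thesis
    unfolding Aut_topology_def openin_subtopology by blast
qed

lemma openin_fixers:
  assumes "finite B"
  shows "openin (Aut_topology E) (fixers E B)"
  using assms
proof (induction B rule: finite_induct)
  case empty
  have "fixers E {} = topspace (Aut_topology E)" by (simp add: fixers_def topspace_Aut_topology)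
  then show ?case by (metis openin_topspace)
next
  case (insert x B)
  have "fixers E (insert x B) = {h \<in> automorphisms E. h x = x} \<inter> fixers E B"
    by (auto simp: fixers_def)
  then show ?case using openin_Int[OF openin_Aut_value insert.IH] by simp
qed

lemma openin_transporters:
  assumes "finite B"
  shows "openin (Aut_topology E) (transporters E B x y)"
proof -
  have "transporters E B x y = {h \<in> automorphisms E. h x = y} \<inter> fixers E B"
    by (auto simp: fixers_def transporters_def)
  then show ?thesis using openin_Int[OF openin_Aut_value openin_fixers[OF assms]] by simp
qed

text \<open>The pointwise stabilizers of finite sets form a neighborhood base at the identity.\<close>

lemma locally_compact_Aut_fixers:
  assumes "locally_compact_space (Aut_topology E)"
  obtains F K where "finite F" "compactin (Aut_topology E) K" "fixers E F \<subseteq> K"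
proof -
  have "id \<in> topspace (Aut_topology E)"
    by (simp add: topspace_Aut_topology automorphisms_def)
  then obtain U K where U: "openin (Aut_topology E) U" "compactin (Aut_topology E) K"
      "id \<in> U" "U \<subseteq> K"
    using assms unfolding locally_compact_space_def by blast
  obtain W where W: "openin (product_topology (\<lambda>_. discrete_topology UNIV) UNIV) W"
      "U = W \<inter> automorphisms E"
    using U(1) unfolding Aut_topology_def openin_subtopology by blast
  have "id \<in> W" using U(3) W(2) by simp
  then obtain S where S: "finite {i. S i \<noteq> UNIV}" "id \<in> PiE UNIV S" "PiE UNIV S \<subseteq> W"
    using W(1) unfolding openin_product_topology_alt by fastforce
  have "fixers E {i. S i \<noteq> UNIV} \<subseteq> K"
  proof
    fix h assume h: "h \<in> fixers E {i. S i \<noteq> UNIV}"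
    have "h i \<in> S i" for i
    proof (cases "S i = UNIV")
      case False
      then have "h i = i" using h by (simp add: fixers_def)
      then show ?thesis using S(2) by (auto simp: PiE_iff)
    qed simp
    then have "h \<in> W" using S(3) by (auto simp: PiE_iff)
    then show "h \<in> K" using h W(2) U(4) by (auto simp: fixers_def)
  qed
  then show ?thesis using that S(1) U(2) by blast
qed

lemma fixers_insert: "fixers E (insert x B) = transporters E B x x"
  by (auto simp: fixers_def transporters_def)

lemma fixers_UN_transporters: "fixers E B = (\<Union>y. transporters E B x y)"
  by (auto simp: transporters_def)

text \<open>An automorphism fixing \<open>i\<close> maps a path from \<open>i\<close> to a path from \<open>i\<close> of the same length, and a
  locally finite graph has finitely many of these.\<close>

lemma finite_orbit_stabilizer:
  assumes lf: "\<And>v. finite (neighbors E v)" and path: "E\<^sup>*\<^sup>* i x"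
  shows "finite {h x | h. h \<in> automorphisms E \<and> h i = i}"
  using path
proof (induction rule: rtranclp_induct)
  case base
  have "{h i | h. h \<in> automorphisms E \<and> h i = i} \<subseteq> {i}" by auto
  then show ?case by (rule finite_subset) simp
next
  case (step y z)
  have "{h z | h. h \<in> automorphisms E \<and> h i = i} \<subseteq>
      (\<Union>w\<in>{h y | h. h \<in> automorphisms E \<and> h i = i}. neighbors E w)"
    using step(2) by (auto simp: neighbors_def automorphism_adj)
  then show ?case by (rule finite_subset) (use step lf in simp)
qed

text \<open>A Haar measure on the automorphism group that is both left and right invariant.\<close>

locale bi_invariant_measure =
  fixes E :: "'v::countable \<Rightarrow> 'v \<Rightarrow> bool" and M :: "('v \<Rightarrow> 'v) measure"
  assumes left: "left_Haar_measure (Aut_group E) (Aut_topology E) M"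
    and right: "right_Haar_measure (Aut_group E) (Aut_topology E) M"
begin

lemma radon: "nonzero_Radon_measure (Aut_topology E) M"
  using left by (simp add: left_Haar_measure_def)

lemma sets_open: "openin (Aut_topology E) U \<Longrightarrow> U \<in> sets M"
  using radon by (auto simp: nonzero_Radon_measure_def)

lemma sets_transporters: "finite B \<Longrightarrow> transporters E B x y \<in> sets M"
  by (simp add: sets_open openin_transporters)

lemma emeasure_transporters_left:
  assumes "finite B" "g \<in> fixers E B"
  shows "emeasure M (transporters E B x (g y)) = emeasure M (transporters E B x y)"
proof -
  have "g \<in> carrier (Aut_group E)" using assms(2) by (simp add: fixers_def Aut_group_def)
  then show ?thesis
    using left sets_transporters[OF assms(1), of x y] l_coset_transporters[OF assms(2), of x y]
    unfolding left_Haar_measure_def by metis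
qed

lemma emeasure_transporters_right:
  assumes "finite B" "g \<in> fixers E B"
  shows "emeasure M (transporters E B (g x) y) = emeasure M (transporters E B x y)"
proof -
  have "g \<in> carrier (Aut_group E)" using assms(2) by (simp add: fixers_def Aut_group_def)
  then show ?thesis
    using right sets_transporters[OF assms(1), of "g x" y] r_coset_transporters[OF assms(2), of x y]
    unfolding right_Haar_measure_def by metis
qed

lemma emeasure_transporters_le:
  assumes "finite B"
  shows "emeasure M (transporters E B x y) \<le> emeasure M (fixers E (insert x B))"
proof (cases "transporters E B x y = {}")
  case False
  then obtain g where g: "g \<in> fixers E B" "g x = y" by (auto simp: transporters_def)
  then show ?thesis
    using emeasure_transporters_left[OF assms g(1), of x x] by (simp add: fixers_insert)
qed simp

text \<open>Each additional fixed vertex \<open>x\<close> splits the stabilizer into countably many cosets, one for each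
  image of \<open>x\<close>. If one of these stabilizers were null, so would be the whole group.\<close>

lemma emeasure_fixers_pos:
  assumes "finite B"
  shows "emeasure M (fixers E B) \<noteq> 0"
proof
  assume "emeasure M (fixers E B) = 0"
  with assms have "emeasure M (fixers E {}) = 0"
  proof (induction B rule: finite_induct)
    case (insert x B)
    have "emeasure M (transporters E B x y) = 0" for y
      using emeasure_transporters_le[OF insert.hyps(1), of x y] insert.prems by simp
    then have "(\<Union>y. transporters E B x y) \<in> null_sets M"
      by (intro null_sets_UN') (auto simp: null_sets_def sets_transporters[OF insert.hyps(1)])
    then have "emeasure M (fixers E B) = 0"
      by (simp add: fixers_UN_transporters[of E B x] null_sets_def)
    then show ?case by (rule insert.IH)
  qed simp
  moreover have "fixers E {} = space M"
    using radon by (simp add: nonzero_Radon_measure_def topspace_Aut_topology fixers_def)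
  ultimately show False using radon by (simp add: nonzero_Radon_measure_def)
qed

text \<open>Fixing further vertices of the component of \<open>i\<close> reduces the stabilizer to a subgroup of finite
  index, so finiteness of the measure passes back to the larger group.\<close>

lemma emeasure_fixers_finite:
  assumes lf: "\<And>v. finite (neighbors E v)" and "finite B" "i \<in> B"
    and "finite F" and path: "\<And>x. x \<in> F \<Longrightarrow> E\<^sup>*\<^sup>* i x"
    and fin: "emeasure M (fixers E (F \<union> B)) < \<infinity>"
  shows "emeasure M (fixers E B) < \<infinity>"
  using \<open>finite F\<close> path fin
proof (induction F rule: finite_induct)
  case (insert x F)
  let ?C = "F \<union> B"
  have C: "finite ?C" using insert.hyps \<open>finite B\<close> by simp
  define Orb where "Orb = {h x | h. h \<in> automorphisms E \<and> h i = i}"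
  have fO: "finite Orb" unfolding Orb_def using lf insert.prems(1) by (intro finite_orbit_stabilizer) auto
  have "fixers E ?C \<subseteq> (\<Union>y\<in>Orb. transporters E ?C x y)"
    using \<open>i \<in> B\<close> by (auto simp: Orb_def fixers_def transporters_def)
  then have "emeasure M (fixers E ?C) \<le> emeasure M (\<Union>y\<in>Orb. transporters E ?C x y)"
    by (rule emeasure_mono) (use fO C sets_transporters in auto)
  also have "\<dots> \<le> (\<Sum>y\<in>Orb. emeasure M (transporters E ?C x y))"
    by (rule emeasure_subadditive_finite) (use fO C sets_transporters in auto)
  also have "\<dots> \<le> (\<Sum>y\<in>Orb. emeasure M (fixers E (insert x ?C)))"
    by (rule sum_mono) (rule emeasure_transporters_le[OF C])
  also have "\<dots> < \<infinity>"
    using insert.prems(2) fO by (simp add: ennreal_mult_less_top of_nat_less_top)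
  finally show ?case using insert by simp
qed simp

end

section \<open>Mass transport along edges\<close>

text \<open>For an invariant transport \<open>f\<close> along the edges, the mass sent by a vertex equals the mass that it
  receives.\<close>

lemma mass_transport:
  fixes E :: "'v::countable \<Rightarrow> 'v \<Rightarrow> bool" and f :: "'v \<Rightarrow> 'v \<Rightarrow> ennreal"
  assumes graph: "locally_finite_simple_graph E"
    and transitive: "transitive_graph E"
    and unimodular: "unimodular_graph E"
    and inv: "\<And>h i j. h \<in> automorphisms E \<Longrightarrow> f (h i) (h j) = f i j"
  shows "(\<Sum>k\<in>neighbors E i. f i k) = (\<Sum>k\<in>neighbors E i. f k i)"
proof -
  let ?N = "neighbors E i"
  have sym: "symp E" and lf: "\<And>v. finite (neighbors E v)"
    using graph by (auto simp: locally_finite_simple_graph_def)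
  obtain M where "left_Haar_measure (Aut_group E) (Aut_topology E) M"
      "right_Haar_measure (Aut_group E) (Aut_topology E) M"
    and lc: "locally_compact_space (Aut_topology E)"
    using unimodular unfolding unimodular_graph_def unimodular_group_def by blast
  then interpret bi_invariant_measure E M by unfold_locales
  obtain F K where F: "finite F" "compactin (Aut_topology E) K" "fixers E F \<subseteq> K"
    using locally_compact_Aut_fixers[OF lc] .
  have "emeasure M (fixers E F) < \<infinity>"
  proof -
    have "compactin (Aut_topology E) K \<Longrightarrow> emeasure M K < \<infinity>"
      using radon by (simp add: nonzero_Radon_measure_def)
    moreover have "emeasure M (fixers E F) \<le> emeasure M K"
    proof (cases "K \<in> sets M")
      case True
      then show ?thesis by (rule emeasure_mono[OF F(3)])
    next
      case False
      \<comment> \<open>This case cannot occur: compact sets are closed, hence Borel.\<close>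
      have "closedin (Aut_topology E) K"
        using F(2) unimodular compactin_imp_closedin
        unfolding unimodular_graph_def unimodular_group_def by blast
      then have "topspace (Aut_topology E) - K \<in> sets M"
        by (intro sets_open) (simp add: closedin_def)
      moreover have "space M = topspace (Aut_topology E)" "K \<subseteq> topspace (Aut_topology E)"
        using radon F(2) compactin_subset_topspace by (auto simp: nonzero_Radon_measure_def)
      ultimately have "K \<in> sets M"
        by (metis double_diff order_refl sets.compl_sets)
      then show ?thesis using False by simp
    qed
    ultimately show ?thesis using F(2) by (auto intro: le_less_trans)
  qed
  \<comment> \<open>Fixing the part of \<open>F\<close> outside the component of \<open>i\<close> makes the measures of the sets
    \<open>S x y\<close> finite without losing transitivity on the component.\<close>
  define B where "B = {x \<in> F. \<not> E\<^sup>*\<^sup>* i x}"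
  have B: "finite B" using F(1) by (simp add: B_def)
  define S where "S = transporters E B"
  define c where "c = emeasure M (S i i)"
  have Sm: "S x y \<in> sets M" for x y unfolding S_def by (rule sets_transporters[OF B])
  have c0: "c \<noteq> 0"
    unfolding c_def S_def fixers_insert[symmetric] using B by (intro emeasure_fixers_pos) simp
  have c_fin: "c < \<infinity>"
    unfolding c_def S_def fixers_insert[symmetric]
  proof (rule emeasure_fixers_finite[where i = i and F = "{x \<in> F. E\<^sup>*\<^sup>* i x}"])
    have "emeasure M (fixers E ({x \<in> F. E\<^sup>*\<^sup>* i x} \<union> insert i B)) \<le> emeasure M (fixers E F)"
      by (rule emeasure_mono)
        (use F(1) in \<open>auto simp: fixers_def B_def intro: sets_open[OF openin_fixers, unfolded fixers_def]\<close>)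
    then show "emeasure M (fixers E ({x \<in> F. E\<^sup>*\<^sup>* i x} \<union> insert i B)) < \<infinity>"
      using \<open>emeasure M (fixers E F) < \<infinity>\<close> by (rule le_less_trans)
  qed (use B F(1) lf in auto)
  have ex: "\<exists>g\<in>fixers E B. g i = k" if "k \<in> ?N" for k
  proof -
    obtain g where g: "g \<in> automorphisms E" "g i = k"
      using transitive by (auto simp: transitive_graph_def)
    have "E\<^sup>*\<^sup>* i (g i)" using that g(2) by (auto simp: neighbors_def)
    then have "(\<lambda>x. if E\<^sup>*\<^sup>* i x then g x else x) \<in> fixers E B"
      using glue_automorphism[OF sym g(1)] by (simp add: fixers_def B_def)
    then show ?thesis
      by (rule bexI[rotated]) (simp add: g(2))
  qed
  have S_out: "emeasure M (S i k) = c" if k: "k \<in> ?N" for k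
    using ex[OF k] emeasure_transporters_left[OF B, of _ i i] by (auto simp: S_def c_def)
  have S_in: "emeasure M (S l i) = c" if l: "l \<in> ?N" for l
    using ex[OF l] emeasure_transporters_right[OF B, of _ i i] by (auto simp: S_def c_def)
  have aut: "h \<in> automorphisms E" if "h \<in> S x y" for h x y
    using that by (simp add: S_def transporters_def fixers_def)
  have symN: "k \<in> ?N \<longleftrightarrow> E k i" for k using sym by (auto simp: neighbors_def dest: sympD)
  \<comment> \<open>Split according to the preimage \<open>l\<close> of \<open>i\<close>, which is a neighbor of \<open>i\<close> because
    \<open>h i = k\<close> is one.\<close>
  have dec_out: "emeasure M (S i k) = (\<Sum>l\<in>?N. emeasure M (S i k \<inter> S l i))" if k: "k \<in> ?N" for k
  proof -
    have "S i k = (\<Union>l\<in>?N. S i k \<inter> S l i)"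
    proof
      show "S i k \<subseteq> (\<Union>l\<in>?N. S i k \<inter> S l i)"
      proof
        fix h assume h: "h \<in> S i k"
        let ?l = "inv_into UNIV h i"
        have hl: "h ?l = i" by (rule automorphism_inv_simps(2)[OF aut[OF h]])
        have "h i = k" using h by (simp add: S_def transporters_def)
        then have "?l \<in> ?N"
          using automorphism_adj[OF aut[OF h], of ?l i] hl symN k by (simp add: neighbors_def)
        moreover have "h \<in> S ?l i" using h hl by (simp add: S_def transporters_def)
        ultimately show "h \<in> (\<Union>l\<in>?N. S i k \<inter> S l i)" using h by blast
      qed
    qed auto
    moreover have "disjoint_family_on (\<lambda>l. S i k \<inter> S l i) ?N"
    proof (unfold disjoint_family_on_def, intro ballI impI)
      fix l m :: 'v assume "l \<noteq> m"
      have False if "h \<in> S l i" "h \<in> S m i" for h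
        using that \<open>l \<noteq> m\<close> bij_is_inj[OF automorphism_bij[OF aut[OF that(1)]]]
        by (auto simp: S_def transporters_def inj_def)
      then show "S i k \<inter> S l i \<inter> (S i k \<inter> S m i) = {}" by blast
    qed
    then have "(\<Sum>l\<in>?N. emeasure M (S i k \<inter> S l i)) = emeasure M (\<Union>l\<in>?N. S i k \<inter> S l i)"
      using Sm lf by (intro sum_emeasure) auto
    ultimately show ?thesis by simp
  qed
  have dec_in: "emeasure M (S l i) = (\<Sum>k\<in>?N. emeasure M (S i k \<inter> S l i))" if l: "l \<in> ?N" for l
  proof -
    have "S l i = (\<Union>k\<in>?N. S i k \<inter> S l i)"
    proof
      show "S l i \<subseteq> (\<Union>k\<in>?N. S i k \<inter> S l i)"
      proof
        fix h assume h: "h \<in> S l i"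
        have "h l = i" using h by (simp add: S_def transporters_def)
        then have "h i \<in> ?N"
          using automorphism_adj[OF aut[OF h], of l i] symN l by (simp add: neighbors_def)
        moreover have "h \<in> S i (h i)" using h by (simp add: S_def transporters_def)
        ultimately show "h \<in> (\<Union>k\<in>?N. S i k \<inter> S l i)" using h by blast
      qed
    qed auto
    moreover have "disjoint_family_on (\<lambda>k. S i k \<inter> S l i) ?N"
      by (auto simp: disjoint_family_on_def S_def transporters_def)
    then have "(\<Sum>k\<in>?N. emeasure M (S i k \<inter> S l i)) = emeasure M (\<Union>k\<in>?N. S i k \<inter> S l i)"
      using Sm lf by (intro sum_emeasure) auto
    ultimately show ?thesis by simp
  qed
  have swap: "f i k * emeasure M (S i k \<inter> S l i) = f l i * emeasure M (S i k \<inter> S l i)" for k l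
  proof (cases "S i k \<inter> S l i = {}")
    case False
    then obtain h where h: "h \<in> S i k" "h \<in> S l i" by blast
    then have "h i = k" "h l = i" by (simp_all add: S_def transporters_def)
    then have "f i k = f l i" using inv[OF aut[OF h(1)], of l i] by simp
    then show ?thesis by simp
  qed simp
  have "c * (\<Sum>k\<in>?N. f i k) = (\<Sum>k\<in>?N. f i k * emeasure M (S i k))"
    by (simp add: sum_distrib_left S_out mult.commute)
  also have "\<dots> = (\<Sum>k\<in>?N. \<Sum>l\<in>?N. f i k * emeasure M (S i k \<inter> S l i))"
    by (simp add: dec_out sum_distrib_left)
  also have "\<dots> = (\<Sum>l\<in>?N. \<Sum>k\<in>?N. f l i * emeasure M (S i k \<inter> S l i))"
    unfolding swap by (rule sum.swap)
  also have "\<dots> = (\<Sum>l\<in>?N. f l i * emeasure M (S l i))"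
    by (simp add: dec_in sum_distrib_left)
  also have "\<dots> = c * (\<Sum>k\<in>?N. f k i)"
    by (simp add: sum_distrib_left S_in mult.commute)
  finally show ?thesis
    using c0 c_fin by (auto simp: ennreal_mult_cancel_left)
qed

section \<open>Majority dynamics\<close>

text \<open>The majority sign disagrees with the fewest voters; the margin over the other sign is at least
  one because the number of voters is odd.\<close>

lemma majority_minimizes_disagreement:
  fixes x :: "'v \<Rightarrow> int"
  assumes "finite V" "odd (card V)" and x: "\<And>j. j \<in> V \<Longrightarrow> x j \<in> {-1, 1}"
  defines "s \<equiv> sgn (\<Sum>j\<in>V. x j)"
  shows "s \<in> {-1, 1}"
    and "y \<in> {-1, 1} \<Longrightarrow>
      card {j \<in> V. s \<noteq> x j} + of_bool (y \<noteq> s) \<le> card {j \<in> V. y \<noteq> x j}"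
    and "2 * card {j \<in> V. s \<noteq> x j} \<le> card V"
proof -
  define a b where "a = card {j \<in> V. x j = 1}" and "b = card {j \<in> V. x j = -1}"
  have V: "V = {j \<in> V. x j = 1} \<union> {j \<in> V. x j = -1}" using x by auto
  have "card V = a + b"
    unfolding a_def b_def by (subst V, rule card_Un_disjoint) (use assms(1) in auto)
  have "(\<Sum>j\<in>V. x j) = (\<Sum>j\<in>{j \<in> V. x j = 1}. x j) + (\<Sum>j\<in>{j \<in> V. x j = -1}. x j)"
    by (subst V, rule sum.union_disjoint) (use assms(1) in auto)
  then have sum: "(\<Sum>j\<in>V. x j) = int a - int b" by (simp add: a_def b_def)
  have ab: "a \<noteq> b" using assms(2) \<open>card V = a + b\<close> by auto
  have "{j \<in> V. 1 \<noteq> x j} = {j \<in> V. x j = -1}" "{j \<in> V. -1 \<noteq> x j} = {j \<in> V. x j = 1}"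
    using x by force+
  then have cards: "card {j \<in> V. 1 \<noteq> x j} = b" "card {j \<in> V. -1 \<noteq> x j} = a"
    by (simp_all add: a_def b_def)
  have s: "s = (if a > b then 1 else -1)" using ab by (auto simp: s_def sum sgn_if)
  then show "s \<in> {-1, 1}" by simp
  show "y \<in> {-1, 1} \<Longrightarrow>
      card {j \<in> V. s \<noteq> x j} + of_bool (y \<noteq> s) \<le> card {j \<in> V. y \<noteq> x j}"
    using ab cards by (auto simp: s)
  show "2 * card {j \<in> V. s \<noteq> x j} \<le> card V"
    using ab cards \<open>card V = a + b\<close> by (auto simp: s)
qed

lemma finite_voters: "locally_finite_simple_graph E \<Longrightarrow> finite (voters E i)"
  by (simp add: voters_def locally_finite_simple_graph_def)

lemma card_voters:
  assumes "locally_finite_simple_graph E"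
  shows "odd (card (voters E i))" "card (voters E i) \<le> Suc (vertex_degree E i)"
proof -
  have "finite (neighbors E i)" "i \<notin> neighbors E i"
    using assms by (auto simp: locally_finite_simple_graph_def neighbors_def irreflp_def)
  then show "odd (card (voters E i))" "card (voters E i) \<le> Suc (vertex_degree E i)"
    by (auto simp: voters_def vertex_degree_def)
qed

lemma majority_dynamics_Suc:
  "majority_dynamics E x (Suc t) i = sgn (\<Sum>j\<in>voters E i. majority_dynamics E x t j)"
  by (simp add: majority_dynamics_def majority_step_def)

lemma majority_dynamics_sign:
  assumes "locally_finite_simple_graph E" "\<And>j. x j \<in> {-1, 1}"
  shows "majority_dynamics E x t i \<in> {-1, 1}"
proof (induction t arbitrary: i)
  case 0
  then show ?case using assms(2) by (simp add: majority_dynamics_def)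
next
  case (Suc t)
  show ?case
    unfolding majority_dynamics_Suc
    by (rule majority_minimizes_disagreement(1)[OF finite_voters card_voters(1)])
      (use assms(1) Suc in auto)
qed

lemma majority_dynamics_equivariant:
  assumes h: "h \<in> automorphisms E"
  shows "majority_dynamics E (x \<circ> inv_into UNIV h) t (h i) = majority_dynamics E x t i"
proof (induction t arbitrary: i)
  case 0
  show ?case by (simp add: majority_dynamics_def automorphism_inv_simps[OF h])
next
  case (Suc t)
  have inj: "inj_on h A" for A
    using automorphism_bij[OF h] by (meson bij_is_inj inj_on_subset subset_UNIV)
  have "vertex_degree E (h i) = vertex_degree E i"
    by (simp add: vertex_degree_def automorphism_neighbors[OF h] card_image[OF inj])
  then have "voters E (h i) = h ` voters E i"
    by (simp add: voters_def automorphism_neighbors[OF h])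
  then show ?case
    by (simp add: majority_dynamics_Suc sum.reindex[OF inj] Suc[unfolded comp_def])
qed

lemma space_opinion_space: "space opinion_space = {x. \<forall>i. x i \<in> {-1, 1}}"
  by (auto simp: opinion_space_def space_PiM PiE_iff)

lemma measurable_opinion [measurable]:
  "(\<lambda>x. x i) \<in> opinion_space \<rightarrow>\<^sub>M count_space UNIV"
proof -
  have "(\<lambda>x. x i) \<in> opinion_space \<rightarrow>\<^sub>M count_space {-1, 1 :: int}"
    unfolding opinion_space_def by (rule measurable_component_singleton) simp
  then show ?thesis
    by (rule measurable_compose) simp
qed

lemma measurable_majority_dynamics [measurable]:
  "(\<lambda>x. majority_dynamics E x t i) \<in> opinion_space \<rightarrow>\<^sub>M count_space UNIV"
proof (induction t arbitrary: i)
  case 0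
  show ?case by (simp add: majority_dynamics_def)
next
  case (Suc t)
  have sum: "(\<lambda>x. \<Sum>j\<in>A. majority_dynamics E x t j) \<in> opinion_space \<rightarrow>\<^sub>M count_space UNIV"
    for A :: "'a set"
  proof (induction A rule: infinite_finite_induct)
    case (insert j A)
    have "(\<lambda>x. k + (\<Sum>j\<in>A. majority_dynamics E x t j)) \<in> opinion_space \<rightarrow>\<^sub>M count_space UNIV" for k
      using insert.IH by (rule measurable_compose) simp
    then have "(\<lambda>x. majority_dynamics E x t j + (\<Sum>j\<in>A. majority_dynamics E x t j))
        \<in> opinion_space \<rightarrow>\<^sub>M count_space UNIV"
      using Suc[of j] by (rule measurable_compose_countable)
    then show ?case using insert.hyps by simp
  qed simp_all
  have "(\<lambda>x. sgn (\<Sum>j\<in>voters E i. majority_dynamics E x t j)) \<in> opinion_space \<rightarrow>\<^sub>M count_space UNIV"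
    by (rule measurable_compose[OF sum]) simp
  then show ?case by (simp only: majority_dynamics_Suc)
qed

lemma measurable_opinion_comp:
  "(\<lambda>x. x \<circ> g) \<in> opinion_space \<rightarrow>\<^sub>M opinion_space"
  unfolding opinion_space_def comp_def
  by (rule measurable_PiM_single') (auto simp: space_PiM PiE_iff)

section \<open>Monotonicity of the expected disagreement\<close>

text \<open>The probability, when the initial opinions have distribution \<open>D\<close>, that \<open>i\<close> at time \<open>t + 1\<close>
  disagrees with \<open>j\<close> at time \<open>t\<close>.\<close>

definition disagreement ::
    "('v \<Rightarrow> 'v \<Rightarrow> bool) \<Rightarrow> ('v \<Rightarrow> int) measure \<Rightarrow> nat \<Rightarrow> 'v \<Rightarrow> 'v \<Rightarrow> ennreal" where
  "disagreement E D t i j =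
     emeasure D {x \<in> space D. majority_dynamics E x (Suc t) i \<noteq> majority_dynamics E x t j}"

lemma disagreement_invariant:
  fixes E :: "'v::countable \<Rightarrow> 'v \<Rightarrow> bool"
  assumes D: "sets D = sets opinion_space" and inv: "Aut_invariant E D"
    and h: "h \<in> automorphisms E"
  shows "disagreement E D t (h i) (h j) = disagreement E D t i j"
proof -
  let ?S = "\<lambda>i j. {x \<in> space opinion_space. majority_dynamics E x (Suc t) i \<noteq> majority_dynamics E x t j}"
  let ?g = "\<lambda>x::'v \<Rightarrow> int. x \<circ> inv_into UNIV h"
  have sp: "space D = space opinion_space" using D by (rule sets_eq_imp_space_eq)
  have g: "?g \<in> D \<rightarrow>\<^sub>M opinion_space"
    using measurable_opinion_comp measurable_cong_sets[OF D refl] by blast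
  have "emeasure D (?S (h i) (h j)) = emeasure (distr D opinion_space ?g) (?S (h i) (h j))"
    using inv h by (simp add: Aut_invariant_def)
  also have "\<dots> = emeasure D (?g -` ?S (h i) (h j) \<inter> space D)"
    by (rule emeasure_distr[OF g]) measurable
  also have "?g -` ?S (h i) (h j) \<inter> space D = ?S i j"
    using measurable_space[OF g] by (auto simp: majority_dynamics_equivariant[OF h] sp)
  finally show ?thesis by (simp add: disagreement_def sp)
qed

lemma of_nat_card_Collect:
  "finite V \<Longrightarrow> of_nat (card {j \<in> V. Q j}) = (\<Sum>j\<in>V. if Q j then 1 else (0 :: ennreal))"
  by (simp add: sum.If_cases Int_def)

lemma measurable_card_Collect:
  assumes "finite V" "\<And>j. j \<in> V \<Longrightarrow> {x \<in> space D. Q x j} \<in> sets D"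
  shows "(\<lambda>x. of_nat (card {j \<in> V. Q x j}) :: ennreal) \<in> borel_measurable D"
  unfolding of_nat_card_Collect[OF assms(1)]
  using assms(2) by (intro borel_measurable_sum measurable_If) auto

lemma sum_emeasure_count:
  assumes "finite V" "\<And>j. j \<in> V \<Longrightarrow> {x \<in> space D. Q x j} \<in> sets D"
  shows "(\<Sum>j\<in>V. emeasure D {x \<in> space D. Q x j}) = (\<integral>\<^sup>+ x. of_nat (card {j \<in> V. Q x j}) \<partial>D)"
proof -
  have "(\<Sum>j\<in>V. emeasure D {x \<in> space D. Q x j}) =
      (\<Sum>j\<in>V. \<integral>\<^sup>+ x. indicator {x \<in> space D. Q x j} x \<partial>D)"
    using assms(2) by simp
  also have "\<dots> = (\<integral>\<^sup>+ x. (\<Sum>j\<in>V. indicator {x \<in> space D. Q x j} x) \<partial>D)"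
    using assms(2) by (intro nn_integral_sum[symmetric]) auto
  also have "\<dots> = (\<integral>\<^sup>+ x. of_nat (card {j \<in> V. Q x j}) \<partial>D)"
  proof (rule nn_integral_cong)
    fix x assume "x \<in> space D"
    then show "(\<Sum>j\<in>V. indicator {x \<in> space D. Q x j} x) = (of_nat (card {j \<in> V. Q x j}) :: ennreal)"
      using assms(1) by (simp add: indicator_def sum.If_cases Int_def)
  qed
  finally show ?thesis .
qed

text \<open>The expected number of voters of \<open>i\<close> at time \<open>t\<close> that disagree with the outcome of their vote
  at time \<open>t + 1\<close>.\<close>

definition energy ::
    "('v \<Rightarrow> 'v \<Rightarrow> bool) \<Rightarrow> ('v \<Rightarrow> int) measure \<Rightarrow> nat \<Rightarrow> 'v \<Rightarrow> ennreal" where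
  "energy E D t i = (\<Sum>j\<in>voters E i. disagreement E D t i j)"

text \<open>By mass transport, the energy at time \<open>t\<close> is the expected number of voters of \<open>i\<close> at time
  \<open>t + 1\<close> that disagree with the opinion of \<open>i\<close> at time \<open>t\<close>. The opinion of \<open>i\<close> at time \<open>t + 2\<close>
  minimizes this number.\<close>

lemma energy_decrease:
  fixes E :: "'v::countable \<Rightarrow> 'v \<Rightarrow> bool"
  assumes graph: "locally_finite_simple_graph E"
    and transitive: "transitive_graph E"
    and unimodular: "unimodular_graph E"
    and D: "sets D = sets opinion_space" and inv: "Aut_invariant E D"
  shows "energy E D (Suc t) i +
      emeasure D {x \<in> space D. majority_dynamics E x (t + 2) i \<noteq> majority_dynamics E x t i}
    \<le> energy E D t i"
proof -
  let ?X = "majority_dynamics E" and ?V = "voters E i"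
  have sp: "space D = space opinion_space" using D by (rule sets_eq_imp_space_eq)
  note [measurable_cong] = D
  have irr: "i \<notin> neighbors E i" and fN: "finite (neighbors E i)"
    using graph by (auto simp: locally_finite_simple_graph_def neighbors_def irreflp_def)
  have fV: "finite ?V" using graph by (rule finite_voters)
  have mt: "(\<Sum>k\<in>neighbors E i. disagreement E D t i k) = (\<Sum>k\<in>neighbors E i. disagreement E D t k i)"
    using graph transitive unimodular disagreement_invariant[OF D inv] by (rule mass_transport)
  have "energy E D (Suc t) i + emeasure D {x \<in> space D. ?X x (t + 2) i \<noteq> ?X x t i} =
      (\<integral>\<^sup>+ x. of_nat (card {j \<in> ?V. ?X x (Suc (Suc t)) i \<noteq> ?X x (Suc t) j}) \<partial>D) +
      (\<integral>\<^sup>+ x. indicator {x \<in> space D. ?X x (t + 2) i \<noteq> ?X x t i} x \<partial>D)"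
    unfolding energy_def disagreement_def by (subst sum_emeasure_count[OF fV]) auto
  also have "\<dots> = (\<integral>\<^sup>+ x. of_nat (card {j \<in> ?V. ?X x (Suc (Suc t)) i \<noteq> ?X x (Suc t) j}) +
      indicator {x \<in> space D. ?X x (t + 2) i \<noteq> ?X x t i} x \<partial>D)"
    by (intro nn_integral_add[symmetric] measurable_card_Collect fV borel_measurable_indicator) measurable
  also have "\<dots> \<le> (\<integral>\<^sup>+ x. of_nat (card {j \<in> ?V. ?X x (Suc t) j \<noteq> ?X x t i}) \<partial>D)"
  proof (rule nn_integral_mono)
    fix x assume x: "x \<in> space D"
    then have pm: "?X x s j \<in> {-1, 1}" for s j
      using majority_dynamics_sign[OF graph, of x s j] by (auto simp: sp space_opinion_space)
    have "card {j \<in> ?V. ?X x (Suc (Suc t)) i \<noteq> ?X x (Suc t) j} + of_bool (?X x t i \<noteq> ?X x (Suc (Suc t)) i)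
        \<le> card {j \<in> ?V. ?X x t i \<noteq> ?X x (Suc t) j}"
      unfolding majority_dynamics_Suc[of E x "Suc t" i]
      by (rule majority_minimizes_disagreement(2)[OF fV card_voters(1)[OF graph] pm pm])
    also have "{j \<in> ?V. ?X x t i \<noteq> ?X x (Suc t) j} = {j \<in> ?V. ?X x (Suc t) j \<noteq> ?X x t i}" by auto
    finally have "(of_nat (card {j \<in> ?V. ?X x (Suc (Suc t)) i \<noteq> ?X x (Suc t) j} +
        of_bool (?X x t i \<noteq> ?X x (Suc (Suc t)) i)) :: ennreal)
        \<le> of_nat (card {j \<in> ?V. ?X x (Suc t) j \<noteq> ?X x t i})"
      by (simp only: of_nat_le_iff)
    then show "(of_nat (card {j \<in> ?V. ?X x (Suc (Suc t)) i \<noteq> ?X x (Suc t) j}) +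
        indicator {x \<in> space D. ?X x (t + 2) i \<noteq> ?X x t i} x :: ennreal)
        \<le> of_nat (card {j \<in> ?V. ?X x (Suc t) j \<noteq> ?X x t i})"
      using x by (auto simp: indicator_def)
  qed
  also have "\<dots> = (\<Sum>j\<in>?V. disagreement E D t j i)"
    unfolding disagreement_def by (subst sum_emeasure_count[OF fV]) auto
  \<comment> \<open>If \<open>i\<close> is its own voter, its term is the same in both sums.\<close>
  also have "\<dots> = energy E D t i"
    using mt fN irr by (simp add: energy_def voters_def)
  finally show ?thesis .
qed

text \<open>At most half of the at most \<open>d + 1\<close> voters disagree with the majority, where \<open>d\<close> is the degree.\<close>

lemma energy_0_le:
  fixes E :: "'v::countable \<Rightarrow> 'v \<Rightarrow> bool"
  assumes graph: "locally_finite_simple_graph E"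
    and D: "sets D = sets opinion_space" and prob: "prob_space D"
  shows "energy E D 0 i \<le> of_nat (vertex_degree E i)"
proof -
  let ?X = "majority_dynamics E" and ?V = "voters E i"
  interpret prob_space D by (rule prob)
  have sp: "space D = space opinion_space" using D by (rule sets_eq_imp_space_eq)
  note [measurable_cong] = D
  have fV: "finite ?V" using graph by (rule finite_voters)
  have "energy E D 0 i = (\<integral>\<^sup>+ x. of_nat (card {j \<in> ?V. ?X x (Suc 0) i \<noteq> ?X x 0 j}) \<partial>D)"
    unfolding energy_def disagreement_def by (subst sum_emeasure_count[OF fV]) auto
  also have "\<dots> \<le> (\<integral>\<^sup>+ x. of_nat (vertex_degree E i) \<partial>D)"
  proof (rule nn_integral_mono)
    fix x assume x: "x \<in> space D"
    then have pm: "?X x 0 j \<in> {-1, 1}" for j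
      using majority_dynamics_sign[OF graph, of x 0 j] by (auto simp: sp space_opinion_space)
    have "2 * card {j \<in> ?V. ?X x (Suc 0) i \<noteq> ?X x 0 j} \<le> card ?V"
      unfolding majority_dynamics_Suc[of E x 0 i]
      by (rule majority_minimizes_disagreement(3)[OF fV card_voters(1)[OF graph] pm])
    then have "card {j \<in> ?V. ?X x (Suc 0) i \<noteq> ?X x 0 j} \<le> vertex_degree E i"
      using card_voters(2)[OF graph, of i] by linarith
    then show "(of_nat (card {j \<in> ?V. ?X x (Suc 0) i \<noteq> ?X x 0 j}) :: ennreal)
        \<le> of_nat (vertex_degree E i)"
      by (simp only: of_nat_le_iff)
  qed
  also have "\<dots> = of_nat (vertex_degree E i)" by (simp add: emeasure_space_1)
  finally show ?thesis .
qed

lemma sum_period_two_changes_le: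
  fixes E :: "'v::countable \<Rightarrow> 'v \<Rightarrow> bool"
  assumes graph: "locally_finite_simple_graph E"
    and transitive: "transitive_graph E"
    and unimodular: "unimodular_graph E"
    and D: "sets D = sets opinion_space" and prob: "prob_space D" and inv: "Aut_invariant E D"
  shows "(\<Sum>t. emeasure D {x \<in> space D.
      majority_dynamics E x (t + 2) i \<noteq> majority_dynamics E x t i}) \<le> of_nat (vertex_degree E i)"
proof -
  let ?p = "\<lambda>t. emeasure D {x \<in> space D. majority_dynamics E x (t + 2) i \<noteq> majority_dynamics E x t i}"
  have "energy E D n i + (\<Sum>t<n. ?p t) \<le> energy E D 0 i" for n
  proof (induction n)
    case (Suc n)
    have "energy E D (Suc n) i + (\<Sum>t<Suc n. ?p t) = energy E D (Suc n) i + ?p n + (\<Sum>t<n. ?p t)"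
      by (simp add: ac_simps)
    also have "\<dots> \<le> energy E D n i + (\<Sum>t<n. ?p t)"
      by (intro add_right_mono energy_decrease[OF graph transitive unimodular D inv])
    finally show ?case using Suc by (rule order_trans)
  qed simp
  then have "(\<Sum>t<n. ?p t) \<le> energy E D 0 i" for n
    by (meson order_trans le_add2 zero_le add_increasing order_refl)
  then have "(\<Sum>t<n. ?p t) \<le> of_nat (vertex_degree E i)" for n
    using energy_0_le[OF graph D prob] by (rule order_trans)
  then show ?thesis by (intro suminf_le_const) auto
qed

section \<open>Almost sure convergence with period two\<close>

lemma tendsto_0_int_iff:
  fixes u :: "nat \<Rightarrow> int"
  shows "u \<longlonglongrightarrow> 0 \<longleftrightarrow> finite {t. u t \<noteq> 0}"
proof -
  have "u \<longlonglongrightarrow> 0 \<longleftrightarrow> eventually (\<lambda>t. u t = 0) sequentially"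
    by (simp add: tendsto_discrete)
  also have "\<dots> \<longleftrightarrow> finite {t. u t \<noteq> 0}"
    unfolding cofinite_eq_sequentially[symmetric] by (simp add: eventually_cofinite)
  finally show ?thesis .
qed

theorem theorem1:
  fixes E :: "'v::countable \<Rightarrow> 'v \<Rightarrow> bool"
    and d :: nat
    and P :: "'w measure"
    and X0 :: "'w \<Rightarrow> 'v \<Rightarrow> int"
    and X :: "nat \<Rightarrow> 'w \<Rightarrow> 'v \<Rightarrow> int"
  assumes graph: "locally_finite_simple_graph E"
    and transitive: "transitive_graph E"
    and unimodular: "unimodular_graph E"
    and degree: "\<And>i. vertex_degree E i = d"
    and prob: "prob_space P"
    and initial: "X0 \<in> P \<rightarrow>\<^sub>M opinion_space"
    and invariant: "Aut_invariant E (distr P opinion_space X0)"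
    and dynamics: "\<And>t \<omega>. X t \<omega> = majority_dynamics E (X0 \<omega>) t"
  shows "\<forall>i. measure P {\<omega> \<in> space P. (\<lambda>t. X (t + 2) \<omega> i - X t \<omega> i) \<longlonglongrightarrow> 0} = 1 \<and>
    (\<integral>\<^sup>+ \<omega>. emeasure (count_space UNIV) {t. X (t + 2) \<omega> i \<noteq> X t \<omega> i} \<partial>P) \<le> of_nat (2 * d)"
proof
  fix i
  interpret prob_space P by (rule prob)
  let ?D = "distr P opinion_space X0"
  let ?A = "\<lambda>t. {\<omega> \<in> space P. X (t + 2) \<omega> i \<noteq> X t \<omega> i}"
  let ?C = "\<lambda>\<omega>. emeasure (count_space UNIV) {t. X (t + 2) \<omega> i \<noteq> X t \<omega> i}"
  note [measurable] = initial
  have [measurable]: "(\<lambda>\<omega>. X t \<omega> i) \<in> P \<rightarrow>\<^sub>M count_space UNIV" for t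
    unfolding dynamics by measurable
  have D: "sets ?D = sets opinion_space" by simp
  have count: "?C \<omega> = (\<Sum>t. indicator (?A t) \<omega>)" if "\<omega> \<in> space P" for \<omega>
  proof -
    have "?C \<omega> = (\<integral>\<^sup>+ t. indicator {t. X (t + 2) \<omega> i \<noteq> X t \<omega> i} t \<partial>count_space UNIV)" by simp
    also have "\<dots> = (\<Sum>t. indicator (?A t) \<omega>)"
      unfolding nn_integral_count_space_nat
      by (rule suminf_cong) (use that in \<open>simp add: indicator_def\<close>)
    finally show ?thesis .
  qed
  have meas [measurable]: "?C \<in> borel_measurable P"
    by (subst measurable_cong[OF count]) measurable
  have "(\<integral>\<^sup>+ \<omega>. ?C \<omega> \<partial>P) = (\<integral>\<^sup>+ \<omega>. (\<Sum>t. indicator (?A t) \<omega>) \<partial>P)"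
    by (rule nn_integral_cong) (rule count)
  also have "\<dots> = (\<Sum>t. \<integral>\<^sup>+ \<omega>. indicator (?A t) \<omega> \<partial>P)"
    by (rule nn_integral_suminf) measurable
  also have "\<dots> = (\<Sum>t. emeasure ?D {x \<in> space ?D.
      majority_dynamics E x (t + 2) i \<noteq> majority_dynamics E x t i})"
  proof (rule suminf_cong)
    fix t
    let ?S = "{x \<in> space ?D. majority_dynamics E x (t + 2) i \<noteq> majority_dynamics E x t i}"
    have S: "?S \<in> sets opinion_space" by simp
    have "emeasure ?D ?S = emeasure P (X0 -` ?S \<inter> space P)"
      by (rule emeasure_distr[OF initial S])
    also have "X0 -` ?S \<inter> space P = ?A t"
      using measurable_space[OF initial] by (auto simp: dynamics)
    finally show "(\<integral>\<^sup>+ \<omega>. indicator (?A t) \<omega> \<partial>P) = emeasure ?D ?S" by simp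
  qed
  also have "\<dots> \<le> of_nat d"
    using sum_period_two_changes_le[OF graph transitive unimodular D prob_space_distr[OF initial]
      invariant, of i] by (simp add: degree)
  finally have le: "(\<integral>\<^sup>+ \<omega>. ?C \<omega> \<partial>P) \<le> of_nat d" .
  then have "(\<integral>\<^sup>+ \<omega>. ?C \<omega> \<partial>P) \<noteq> \<infinity>" by (auto simp: top_unique)
  then have ae: "AE \<omega> in P. ?C \<omega> \<noteq> \<infinity>" by (rule nn_integral_noteq_infinite[OF meas])
  have "(\<lambda>t. X (t + 2) \<omega> i - X t \<omega> i) \<longlonglongrightarrow> 0 \<longleftrightarrow> ?C \<omega> \<noteq> \<infinity>" for \<omega>
    by (auto simp: tendsto_0_int_iff emeasure_count_space)
  then have "measure P {\<omega> \<in> space P. (\<lambda>t. X (t + 2) \<omega> i - X t \<omega> i) \<longlonglongrightarrow> 0} = 1"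
    using ae by (simp only:) (subst prob_Collect_eq_1, measurable)
  moreover have "(of_nat d :: ennreal) \<le> of_nat (2 * d)" by (simp only: of_nat_le_iff)
  ultimately show "measure P {\<omega> \<in> space P. (\<lambda>t. X (t + 2) \<omega> i - X t \<omega> i) \<longlonglongrightarrow> 0} = 1 \<and>
      (\<integral>\<^sup>+ \<omega>. ?C \<omega> \<partial>P) \<le> of_nat (2 * d)"
    using le by (blast intro: order_trans)
qed

end
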